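(* The dihedral quandle $R_3$ of order $3$ is a subquandle of $M_{\lambda,-\lambda}$ for any $\lambda\in\mathbb{C}^*$ (that is, $M_{\lambda,-\lambda}$ contains a subquandle isomorphic to $R_3$).
   Context: A quandle is a non-empty set $Q$ with a binary operation $*$ such that: (Q1) $x*x=x$ for all $x$; (Q2) for all $x,y\in Q$ there is a unique $z\in Q$ with $x=z*y$; (Q3) $(x*y)*z=(x*z)*(y*z)$ for all $x,y,z$. A subquandle is a subset that is a quandle under the same operation. A quandle isomorphism is a bijection $\phi$ with $\phi(x*y)=\phi(x)*\phi(y)$. $R_3=\{0,1,2\}$ with $i*j=2j-i \bmod 3$. $M_{\lambda_1,\lambda_2}$ is the conjugacy class in $\operatorname{GL}(2,\mathbb{C})$ of $\begin{pmatrix}\lambda_1&0\\0&\lambda_2\end{pmatrix}$, regarded as a quandle with operation $X*Y=Y^{-1}XY$. *)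

theory Defs
  imports "HOL-Analysis.Analysis"
begin

locale quandle =
  fixes Q :: "'a set" and qop :: "'a \<Rightarrow> 'a \<Rightarrow> 'a" (infixl "\<triangleright>" 70)
  assumes nonempty: "Q \<noteq> {}"
    and closed: "\<lbrakk>x \<in> Q; y \<in> Q\<rbrakk> \<Longrightarrow> x \<triangleright> y \<in> Q"
    and idem: "x \<in> Q \<Longrightarrow> x \<triangleright> x = x"
    and right_div: "\<lbrakk>x \<in> Q; y \<in> Q\<rbrakk> \<Longrightarrow> \<exists>!z. z \<in> Q \<and> x = z \<triangleright> y"
    and right_distrib:
      "\<lbrakk>x \<in> Q; y \<in> Q; z \<in> Q\<rbrakk> \<Longrightarrow> (x \<triangleright> y) \<triangleright> z = (x \<triangleright> z) \<triangleright> (y \<triangleright> z)"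

definition subquandle :: "'a set \<Rightarrow> 'a set \<Rightarrow> ('a \<Rightarrow> 'a \<Rightarrow> 'a) \<Rightarrow> bool" where
  "subquandle S Q f \<longleftrightarrow> quandle Q f \<and> S \<subseteq> Q \<and> quandle S f"

definition quandle_iso ::
  "('a \<Rightarrow> 'b) \<Rightarrow> 'a set \<Rightarrow> ('a \<Rightarrow> 'a \<Rightarrow> 'a) \<Rightarrow> 'b set \<Rightarrow> ('b \<Rightarrow> 'b \<Rightarrow> 'b) \<Rightarrow> bool" where
  "quandle_iso \<phi> Q f Q' f' \<longleftrightarrow>
     quandle Q f \<and> quandle Q' f' \<and> bij_betw \<phi> Q Q' \<and>
     (\<forall>x\<in>Q. \<forall>y\<in>Q. \<phi> (f x y) = f' (\<phi> x) (\<phi> y))"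

definition quandle_isomorphic ::
  "'a set \<Rightarrow> ('a \<Rightarrow> 'a \<Rightarrow> 'a) \<Rightarrow> 'b set \<Rightarrow> ('b \<Rightarrow> 'b \<Rightarrow> 'b) \<Rightarrow> bool" where
  "quandle_isomorphic Q f Q' f' \<longleftrightarrow> (\<exists>\<phi>. quandle_iso \<phi> Q f Q' f')"

definition R3 :: "int set" where
  "R3 = {0, 1, 2}"

definition R3_op :: "int \<Rightarrow> int \<Rightarrow> int" where
  "R3_op i j = (2 * j - i) mod 3"

definition GL2 :: "(complex ^ 2 ^ 2) set" where
  "GL2 = {A. invertible A}"

definition conj_class_GL2 :: "complex ^ 2 ^ 2 \<Rightarrow> (complex ^ 2 ^ 2) set" where
  "conj_class_GL2 A = {matrix_inv P ** A ** P |P. P \<in> GL2}"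

definition diag2 :: "complex \<Rightarrow> complex \<Rightarrow> complex ^ 2 ^ 2" where
  "diag2 a b = vector [vector [a, 0], vector [0, b]]"

definition M :: "complex \<Rightarrow> complex \<Rightarrow> (complex ^ 2 ^ 2) set" where
  "M a b = conj_class_GL2 (diag2 a b)"

definition M_op :: "complex ^ 2 ^ 2 \<Rightarrow> complex ^ 2 ^ 2 \<Rightarrow> complex ^ 2 ^ 2" where
  "M_op X Y = matrix_inv Y ** X ** Y"

end

theory Submission
  imports Defs
begin

text \<open>
  The transpositions of the symmetric group on three letters form a conjugacy class isomorphic to
  \<open>R3\<close>, and the faithful two-dimensional representation of that group makes them linear reflections
  with eigenvalues \<open>1\<close> and \<open>-1\<close>. Scaling by \<open>l\<close> does not affect conjugation relations, apart from
  turning these eigenvalues into \<open>l\<close> and \<open>- l\<close>, so three scaled reflections give the required copy.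

  In a basis diagonalising the three-cycle, with \<open>w\<close> a primitive cube root of unity, the scaled
  reflections are the antidiagonal matrices \<open>F k\<close> with entries \<open>l * w powi k\<close> and \<open>l * w powi (- k)\<close>.
  Both \<open>F i ** F j\<close> and \<open>F j ** F (2 * j - i)\<close> are diagonal with entries \<open>l\<^sup>2 * w powi (i - j)\<close>
  and \<open>l\<^sup>2 * w powi (j - i)\<close>; that is the dihedral operation, and it descends to residues modulo
  \<open>3\<close> because \<open>w ^ 3 = 1\<close> (lemma \<open>M_op_scaled_reflection\<close>). The rows \<open>(1, w powi k)\<close>
  and \<open>(1, - w powi k)\<close> are left eigenvectors of \<open>F k\<close> for \<open>l\<close> and \<open>- l\<close>, which puts \<open>F k\<close> in the
  conjugacy class (lemma \<open>scaled_reflection_in_M\<close>).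

  Inverse matrices are avoided almost everywhere by expressing a conjugation \<open>Z = Y\<inverse> X Y\<close> as the
  intertwining relation \<open>X Y = Y Z\<close>.
\<close>

section \<open>Conjugation quandles of matrices\<close>

lemma invertible_matrix_inv:
  fixes Y :: "'a::semiring_1 ^ 'n ^ 'm"
  assumes "invertible Y"
  shows "Y ** matrix_inv Y = mat 1" "matrix_inv Y ** Y = mat 1"
proof -
  have "\<exists>B. Y ** B = mat 1 \<and> B ** Y = mat 1"
    using assms by (simp add: invertible_def)
  then have "Y ** matrix_inv Y = mat 1 \<and> matrix_inv Y ** Y = mat 1"
    unfolding matrix_inv_def by (rule someI_ex)
  then show "Y ** matrix_inv Y = mat 1" "matrix_inv Y ** Y = mat 1"
    by auto
qed

lemma matrix_mul_left_cancel:
  fixes Y :: "'a::semiring_1 ^ 'n ^ 'm"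
  assumes "invertible Y" "Y ** A = Y ** B"
  shows "A = B"
proof -
  have "matrix_inv Y ** (Y ** A) = matrix_inv Y ** (Y ** B)"
    using assms(2) by simp
  then show ?thesis
    by (simp add: matrix_mul_assoc invertible_matrix_inv[OF assms(1)])
qed

lemma M_op_eq_iff:
  assumes "invertible Y"
  shows "M_op X Y = Z \<longleftrightarrow> X ** Y = Y ** Z"
proof
  assume "M_op X Y = Z"
  then have "Y ** Z = (Y ** matrix_inv Y) ** X ** Y"
    by (auto simp: M_op_def matrix_mul_assoc)
  then show "X ** Y = Y ** Z"
    by (simp add: invertible_matrix_inv[OF assms])
next
  assume "X ** Y = Y ** Z"
  then have "M_op X Y = matrix_inv Y ** Y ** Z"
    by (simp add: M_op_def flip: matrix_mul_assoc)
  then show "M_op X Y = Z"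
    by (simp add: invertible_matrix_inv[OF assms])
qed

lemma M_op_intertwines:
  assumes "invertible Y"
  shows "X ** Y = Y ** M_op X Y"
  using M_op_eq_iff[OF assms] by blast

lemma conj_class_GL2_iff:
  "X \<in> conj_class_GL2 A \<longleftrightarrow> (\<exists>P. invertible P \<and> A ** P = P ** X)"
proof -
  have "X \<in> conj_class_GL2 A \<longleftrightarrow> (\<exists>P. invertible P \<and> M_op A P = X)"
    by (auto simp: conj_class_GL2_def GL2_def M_op_def)
  then show ?thesis
    using M_op_eq_iff by blast
qed

lemma conj_class_GL2_invertible:
  assumes "invertible A" "X \<in> conj_class_GL2 A"
  shows "invertible X"
proof -
  obtain P where P: "invertible P" "A ** P = P ** X"
    using assms(2) conj_class_GL2_iff by blast
  have "det A * det P = det P * det X"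
    using P(2) by (metis det_mul)
  then show ?thesis
    using assms(1) P(1) by (auto simp: invertible_det_nz)
qed

lemma M_op_in_conj_class_GL2:
  assumes "X \<in> conj_class_GL2 A" "invertible Y"
  shows "M_op X Y \<in> conj_class_GL2 A"
proof -
  obtain P where P: "invertible P" "A ** P = P ** X"
    using assms(1) conj_class_GL2_iff by blast
  have "A ** (P ** Y) = P ** (X ** Y)"
    by (simp add: matrix_mul_assoc P(2))
  also have "\<dots> = (P ** Y) ** M_op X Y"
    by (simp add: M_op_intertwines[OF assms(2), of X] matrix_mul_assoc)
  finally show ?thesis
    using P(1) assms(2) invertible_mult conj_class_GL2_iff by blast
qed

text \<open>
  Closure under conjugation by arbitrary invertible matrices provides right division as well: the
  quotient of \<open>X\<close> by \<open>Y\<close> is the conjugate of \<open>X\<close> by the inverse of \<open>Y\<close>. Distributivity holds since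
  conjugation by a fixed matrix is a homomorphism.
\<close>

lemma quandle_conj_class_GL2:
  assumes "invertible A"
  shows "quandle (conj_class_GL2 A) M_op"
proof
  note inv = conj_class_GL2_invertible[OF assms]
  have "A \<in> conj_class_GL2 A"
    unfolding conj_class_GL2_iff using assms by blast
  then show "conj_class_GL2 A \<noteq> {}"
    by blast
  fix X Y assume X: "X \<in> conj_class_GL2 A" and Y: "Y \<in> conj_class_GL2 A"
  show "M_op X Y \<in> conj_class_GL2 A"
    by (rule M_op_in_conj_class_GL2[OF X inv[OF Y]])
  show "M_op X X = X"
    using M_op_eq_iff[OF inv[OF X]] by blast
  show "\<exists>!V. V \<in> conj_class_GL2 A \<and> X = M_op V Y"
  proof
    let ?V = "Y ** X ** matrix_inv Y"
    have "invertible (matrix_inv Y)"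
      using invertible_matrix_inv[OF inv[OF Y]] invertible_def by blast
    moreover have "M_op X (matrix_inv Y) = ?V"
      unfolding M_op_eq_iff[OF \<open>invertible (matrix_inv Y)\<close>]
      by (simp add: matrix_mul_assoc invertible_matrix_inv[OF inv[OF Y]])
    ultimately have "?V \<in> conj_class_GL2 A"
      using M_op_in_conj_class_GL2[OF X] by metis
    moreover have "?V ** Y = Y ** X"
      using invertible_matrix_inv(2)[OF inv[OF Y]] by (simp flip: matrix_mul_assoc)
    ultimately show "?V \<in> conj_class_GL2 A \<and> X = M_op ?V Y"
      by (simp add: M_op_eq_iff[OF inv[OF Y]] eq_commute[of X])
  next
    fix V assume "V \<in> conj_class_GL2 A \<and> X = M_op V Y"
    then have "V ** Y = Y ** X"
      by (simp add: M_op_intertwines[OF inv[OF Y], of V])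
    then have "V ** (Y ** matrix_inv Y) = Y ** X ** matrix_inv Y"
      by (simp add: matrix_mul_assoc)
    then show "V = Y ** X ** matrix_inv Y"
      by (simp add: invertible_matrix_inv[OF inv[OF Y]])
  qed
  fix Z assume Z: "Z \<in> conj_class_GL2 A"
  let ?W = "M_op Y Z" and ?T = "M_op (M_op X Y) Z"
  have "?W \<in> conj_class_GL2 A"
    by (rule M_op_in_conj_class_GL2[OF Y inv[OF Z]])
  have "Z ** (M_op X Z ** ?W) = X ** Z ** ?W"
    by (simp add: M_op_intertwines[OF inv[OF Z], of X] matrix_mul_assoc)
  also have "\<dots> = X ** Y ** Z"
    by (simp add: M_op_intertwines[OF inv[OF Z], of Y] flip: matrix_mul_assoc)
  also have "\<dots> = Y ** (M_op X Y ** Z)"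
    by (simp add: M_op_intertwines[OF inv[OF Y], of X] matrix_mul_assoc)
  also have "\<dots> = Y ** Z ** ?T"
    by (simp add: M_op_intertwines[OF inv[OF Z], of "M_op X Y"] matrix_mul_assoc)
  also have "\<dots> = Z ** (?W ** ?T)"
    by (simp add: M_op_intertwines[OF inv[OF Z], of Y] matrix_mul_assoc)
  finally have "M_op X Z ** ?W = ?W ** ?T"
    by (rule matrix_mul_left_cancel[OF inv[OF Z]])
  then show "?T = M_op (M_op X Z) ?W"
    using M_op_eq_iff[OF inv[OF \<open>?W \<in> conj_class_GL2 A\<close>]] by metis
qed

section \<open>Transport of quandle structures\<close>

text \<open>
  An operation on the image of a quandle need not be checked against the axioms: an injective
  homomorphism carries each of them over, including the uniqueness of right quotients.
\<close>

lemma quandle_iso_image: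
  assumes Q: "quandle Q f" and inj: "inj_on \<phi> Q"
    and hom: "\<And>x y. x \<in> Q \<Longrightarrow> y \<in> Q \<Longrightarrow> g (\<phi> x) (\<phi> y) = \<phi> (f x y)"
  shows "quandle_iso \<phi> Q f (\<phi> ` Q) g"
proof -
  interpret quandle Q f by (rule Q)
  have "quandle (\<phi> ` Q) g"
  proof
    show "\<phi> ` Q \<noteq> {}"
      using nonempty by blast
    fix a b assume "a \<in> \<phi> ` Q" "b \<in> \<phi> ` Q"
    then obtain x y where x: "x \<in> Q" "a = \<phi> x" and y: "y \<in> Q" "b = \<phi> y"
      by blast
    show "g a b \<in> \<phi> ` Q"
      using x y closed hom by auto
    show "g a a = a"
      using x idem hom by auto
    obtain z where z: "z \<in> Q" "x = f z y"
      using right_div x y by blast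
    show "\<exists>!c. c \<in> \<phi> ` Q \<and> a = g c b"
    proof
      show "\<phi> z \<in> \<phi> ` Q \<and> a = g (\<phi> z) b"
        using x y z hom by auto
    next
      fix c assume "c \<in> \<phi> ` Q \<and> a = g c b"
      then obtain z' where z': "z' \<in> Q" "c = \<phi> z'" "\<phi> x = \<phi> (f z' y)"
        using x y hom by auto
      then have "x = f z' y"
        using inj x y closed by (meson inj_onD)
      then show "c = \<phi> z"
        using right_div x y z z' by blast
    qed
    fix c assume "c \<in> \<phi> ` Q"
    then obtain u where u: "u \<in> Q" "c = \<phi> u"
      by blast
    show "g (g a b) c = g (g a c) (g b c)"
      using x y u right_distrib[of x y u] by (simp add: hom closed)
  qed
  then show ?thesis
    using Q inj hom by (auto simp: quandle_iso_def bij_betw_def)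
qed

lemma quandle_R3: "quandle R3 R3_op"
proof
  show "R3 \<noteq> {}"
    by (simp add: R3_def)
  fix x y assume x: "x \<in> R3" and y: "y \<in> R3"
  show "R3_op x y \<in> R3"
    unfolding R3_op_def R3_def by (simp, presburger)
  show "R3_op x x = x"
    using x by (auto simp: R3_def R3_op_def)
  \<comment> \<open>Each right translation is an involution.\<close>
  show "\<exists>!z. z \<in> R3 \<and> x = R3_op z y"
    by (rule ex1I[of _ "R3_op x y"]) (use x y in \<open>auto simp: R3_def R3_op_def\<close>)
  fix z assume "z \<in> R3"
  then show "R3_op (R3_op x y) z = R3_op (R3_op x z) (R3_op y z)"
    using x y by (auto simp: R3_def R3_op_def)
qed

section \<open>Scaled reflections\<close>

text \<open>
  Diagonalising the three-cycle rather than a reflection gives all reflections the same antidiagonal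
  shape, so no case distinction on \<open>k\<close> is needed; integer exponents make this periodic in \<open>k\<close> when
  \<open>w\<close> is a root of unity.
\<close>

definition scaled_reflection :: "complex \<Rightarrow> complex \<Rightarrow> int \<Rightarrow> complex ^ 2 ^ 2" where
  "scaled_reflection l w k = vector [vector [0, l * w powi k], vector [l * w powi (- k), 0]]"

text \<open>
  The rows of the intertwining matrix \<open>P\<close> are left eigenvectors for the eigenvalues \<open>l\<close> and \<open>- l\<close>.
\<close>

lemma scaled_reflection_in_M:
  assumes "w \<noteq> 0"
  shows "scaled_reflection l w k \<in> M l (- l)"
proof -
  define P :: "complex ^ 2 ^ 2"
    where "P = vector [vector [1, w powi k], vector [1, - (w powi k)]]"
  have "diag2 l (- l) ** P = P ** scaled_reflection l w k"
    using assms by (simp add: P_def diag2_def scaled_reflection_def vec_eq_iff forall_2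
        matrix_matrix_mult_def sum_2 power_int_minus)
  moreover have "invertible P"
    using assms by (simp add: P_def invertible_det_nz det_2)
  ultimately show ?thesis
    unfolding M_def conj_class_GL2_iff by blast
qed

lemma power_int_mod_order:
  fixes w :: "'a::field"
  assumes "w ^ n = 1" "w \<noteq> 0"
  shows "w powi (k mod int n) = w powi k"
proof -
  have "w powi k = w powi (int n * (k div int n) + k mod int n)"
    by simp
  also have "\<dots> = (w powi int n) powi (k div int n) * w powi (k mod int n)"
    using \<open>w \<noteq> 0\<close> by (simp only: power_int_add power_int_mult simp_thms)
  finally show ?thesis
    using assms by simp
qed

text \<open>
  In terms of \<open>F k = scaled_reflection l w k\<close>, the product \<open>F i ** F j\<close> is diagonal and depends only
  on \<open>i - j\<close>. Hence it equals \<open>F j ** F k\<close> as soon as \<open>i - j = j - k\<close>, that is \<open>k = 2 * j - i\<close>.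
\<close>

lemma M_op_scaled_reflection:
  assumes "l \<noteq> 0" "w ^ 3 = 1"
  shows "M_op (scaled_reflection l w i) (scaled_reflection l w j)
    = scaled_reflection l w (R3_op i j)"
proof -
  have w: "w \<noteq> 0"
    using assms(2) by auto
  have "invertible (scaled_reflection l w j)"
    using assms(1) w by (simp add: scaled_reflection_def invertible_det_nz det_2)
  moreover have "scaled_reflection l w i ** scaled_reflection l w j
      = scaled_reflection l w j ** scaled_reflection l w (R3_op i j)"
    using w by (simp add: scaled_reflection_def vec_eq_iff forall_2 matrix_matrix_mult_def sum_2
        R3_op_def power_int_minus power_int_mod_order[OF assms(2) w, simplified] power_int_diff
        power_int_mult power2_eq_square field_simps mult_2 power_int_add)
  ultimately show ?thesis
    by (simp add: M_op_eq_iff)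
qed

lemma inj_on_scaled_reflection:
  assumes "l \<noteq> 0" "w ^ 3 = 1" "w \<noteq> 1"
  shows "inj_on (scaled_reflection l w) R3"
proof (rule inj_onI)
  fix i j assume ij: "i \<in> R3" "j \<in> R3" "scaled_reflection l w i = scaled_reflection l w j"
  then have "scaled_reflection l w i $ 1 $ 2 = scaled_reflection l w j $ 1 $ 2"
    by simp
  then have eq: "w powi i = w powi j"
    using assms(1) by (simp add: scaled_reflection_def)
  have "w ^ 2 \<noteq> 1" "w ^ 2 \<noteq> w"
    using assms(2,3) by (auto simp: power2_eq_square power3_eq_cube)
  then show "i = j"
    using ij(1,2) eq assms(3) by (auto simp: R3_def)
qed

lemma primitive_cube_root_of_unity: "\<exists>w :: complex. w ^ 3 = 1 \<and> w \<noteq> 1"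
proof -
  have "cis (2 * pi / 3) ^ 3 = 1"
    by (simp add: Complex.DeMoivre)
  moreover have "cos (2 * pi / 3) \<noteq> 1"
    by (simp add: cos_120)
  then have "cis (2 * pi / 3) \<noteq> 1"
    by (metis cis.sel(1) one_complex.sel(1))
  ultimately show ?thesis
    by blast
qed

theorem theorem6p11:
  fixes l :: complex
  assumes "l \<noteq> 0"
  shows "\<exists>S. subquandle S (M l (- l)) M_op \<and> quandle_isomorphic R3 R3_op S M_op"
proof -
  obtain w :: complex where w: "w ^ 3 = 1" "w \<noteq> 1"
    using primitive_cube_root_of_unity by blast
  then have "w \<noteq> 0"
    by auto
  let ?F = "scaled_reflection l w"
  have iso: "quandle_iso ?F R3 R3_op (?F ` R3) M_op"
    using quandle_iso_image[OF quandle_R3 inj_on_scaled_reflection[OF assms w]]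
      M_op_scaled_reflection[OF assms w(1)] by blast
  have "invertible (diag2 l (- l))"
    using assms by (simp add: diag2_def invertible_det_nz det_2)
  then have "quandle (M l (- l)) M_op"
    unfolding M_def by (rule quandle_conj_class_GL2)
  moreover have "?F ` R3 \<subseteq> M l (- l)"
    using scaled_reflection_in_M[OF \<open>w \<noteq> 0\<close>] by blast
  ultimately have "subquandle (?F ` R3) (M l (- l)) M_op"
    using iso by (simp add: subquandle_def quandle_iso_def)
  then show ?thesis
    using iso quandle_isomorphic_def by blast
qed

end
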